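(* The cylinders $\Delta^{3'}_{c_1c_2\ldots c_n}$ ($n\ge1$, $c_j\in\{0,1,2\}$) have the following properties: (1) A cylinder $\Delta^{3'}_{c_1c_2\ldots c_n}$ is a closed interval and $\Delta^{3'}_{c_1c_2\ldots c_n}=\left[\Delta^{3'}_{c_1c_2\ldots c_n(0)},\Delta^{3'}_{c_1c_2\ldots c_n(2)}\right]$. (2) $\left|\Delta^{3'}_{c_1c_2\ldots c_n}\right|=\frac{1}{3^n}$. (3) $\Delta^{3'}_{c_1c_2\ldots c_nc}\subset\Delta^{3'}_{c_1c_2\ldots c_n}$ for $c\in\{0,1,2\}$. (4) $\Delta^{3'}_{c_1c_2\ldots c_n}=\bigcup_{c=0}^{2}\Delta^{3'}_{c_1c_2\ldots c_nc}$. (5) The cylinders $\Delta^{3'}_{c_1c_2\ldots c_n}$ are left-to-right situated.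
   Context: Let $\theta:\{0,1,2\}\to\{0,1,2\}$, $\theta(0)=0$, $\theta(1)=2$, $\theta(2)=1$. For digits $\alpha_n\in\{0,1,2\}$ and $\beta_n=\theta(\alpha_n)$, put $\Delta^{3'}_{\beta_1\beta_2\ldots}=\sum_{n\ge1}\theta(\alpha_n)3^{-n}=\sum_{n\ge1}\beta_n3^{-n}$. Parentheses denote a period. For $c_1,\ldots,c_n\in\{0,1,2\}$ the cylinder of rank $n$ with base $c_1\ldots c_n$ is $$\Delta^{3'}_{c_1\ldots c_n}=\{x: x=\Delta^{3'}_{c_1\ldots c_n\beta_{n+1}\beta_{n+2}\ldots},\ \beta_t\in\{0,1,2\},\ t>n\}.$$ $|\cdot|$ denotes Lebesgue measure. "Left-to-right situated" means that $\sup\Delta^{3'}_{c_1\ldots c_{n-1}c}=\inf\Delta^{3'}_{c_1\ldots c_{n-1}[c+1]}$ for $c\in\{0,1\}$. *)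

theory Defs
  imports "HOL-Analysis.Analysis" "HOL-Library.Stream"
begin

abbreviation digits :: "nat set" where
  "digits \<equiv> {0, 1, 2}"

definition theta :: "nat \<Rightarrow> nat" where
  "theta a = (if a = 1 then 2 else if a = 2 then 1 else a)"

text \<open>The subscripts of \<open>\<Delta>\<^sup>3\<^sup>'\<close> are the digits \<open>\<beta>\<^sub>n = \<theta> (\<alpha>\<^sub>n)\<close> themselves.
  Streams are indexed from 0, so \<open>b !! n\<close> is \<open>\<beta>\<^bsub>n+1\<^esub>\<close>.\<close>

definition delta3 :: "nat stream \<Rightarrow> real" where
  "delta3 b = (\<Sum>n. real (b !! n) / 3 ^ Suc n)"

text \<open>The two forms of the series agree, and since \<open>\<theta>\<close> is a bijection on the digits,
  every digit sequence occurs as a sequence \<open>\<beta>\<close>.\<close>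

lemma delta3_theta: "delta3 (smap theta a) = (\<Sum>n. real (theta (a !! n)) / 3 ^ Suc n)"
  by (simp add: delta3_def)

lemma bij_betw_theta: "bij_betw theta digits digits"
  by (auto simp: bij_betw_def inj_on_def theta_def)

lemma smap_theta_surj:
  assumes "sset b \<subseteq> digits"
  shows "\<exists>a. sset a \<subseteq> digits \<and> b = smap theta a"
proof (intro exI conjI)
  show "sset (smap theta b) \<subseteq> digits"
    using assms by (auto simp: stream.set_map theta_def)
  have "theta (theta x) = x" for x
    by (simp add: theta_def)
  then show "b = smap theta (smap theta b)"
    by (simp add: stream.map_comp comp_def stream.map_ident)
qed

definition cylinder :: "nat list \<Rightarrow> real set" where
  "cylinder c = {x. \<exists>b. sset b \<subseteq> digits \<and> x = delta3 (c @- b)}"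

end

theory Submission
  imports Defs
begin

text \<open>
  Prepending a digit \<open>c\<close> to a digit stream acts on its value as the affine contraction
  \<open>x \<mapsto> (c + x) / 3\<close> (\<open>delta3_SCons\<close>). Prepending a word \<open>cs\<close> of length \<open>n\<close> is therefore the
  composite of \<open>n\<close> such maps, that is, \<open>x \<mapsto> p + x / 3 ^ n\<close>, where \<open>p\<close> is the value of \<open>cs\<close>
  followed by zeros (\<open>delta3_shift\<close>).

  The values of all digit streams fill exactly the unit interval: they lie in it by comparison
  with the geometric series (\<open>delta3_bounds\<close>), and every point of it has a ternary expansion
  (\<open>delta3_surj\<close>). Hence the cylinder with base \<open>cs\<close> is the affine image
  \<open>{p .. p + 1 / 3 ^ n}\<close> of the unit interval (\<open>cylinder_eq\<close>). Appending a digit \<open>c\<close> to \<open>cs\<close> moves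
  the left endpoint by \<open>c / 3 ^ Suc n\<close> (\<open>cylinder_snoc\<close>), so the three subcylinders are the
  consecutive thirds of their parent, and the claimed properties are facts about these
  intervals.
\<close>

lemma geometric_third_sums_1: "(\<lambda>n. 2 / 3 ^ Suc n :: real) sums 1"
proof -
  have "(\<lambda>n. (2 / 3) * (1 / 3) ^ n :: real) sums ((2 / 3) * (1 / (1 - 1 / 3)))"
    by (intro sums_mult geometric_sums) simp
  then show ?thesis
    by (simp add: power_divide field_simps)
qed

lemma digit_term_le:
  assumes "sset b \<subseteq> digits"
  shows "real (b !! n) / 3 ^ Suc n \<le> 2 / 3 ^ Suc n"
proof -
  have "b !! n \<in> digits"
    using assms snth_sset by blast
  then show ?thesis
    by (intro divide_right_mono) auto
qed

lemma summable_delta3: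
  assumes "sset b \<subseteq> digits"
  shows "summable (\<lambda>n. real (b !! n) / 3 ^ Suc n)"
proof (rule summable_comparison_test')
  show "summable (\<lambda>n. 2 / 3 ^ Suc n :: real)"
    using geometric_third_sums_1 by (rule sums_summable)
  show "norm (real (b !! n) / 3 ^ Suc n) \<le> 2 / 3 ^ Suc n" if "n \<ge> 0" for n
    using digit_term_le[OF assms, of n] by simp
qed

lemma delta3_bounds:
  assumes "sset b \<subseteq> digits"
  shows "delta3 b \<in> {0..1}"
proof -
  have "delta3 b \<le> (\<Sum>n. 2 / 3 ^ Suc n)"
    unfolding delta3_def
    by (intro suminf_le digit_term_le summable_delta3 assms
        sums_summable[OF geometric_third_sums_1])
  moreover have "0 \<le> delta3 b"
    unfolding delta3_def by (intro suminf_nonneg summable_delta3 assms) simp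
  ultimately show ?thesis
    using sums_unique[OF geometric_third_sums_1] by simp
qed

lemma delta3_SCons:
  assumes "sset b \<subseteq> digits" and "c \<in> digits"
  shows "delta3 (c ## b) = (real c + delta3 b) / 3"
proof -
  have "summable (\<lambda>n. real ((c ## b) !! n) / 3 ^ Suc n)"
    using assms by (intro summable_delta3) auto
  then have "delta3 (c ## b) = real c / 3 + (\<Sum>n. real (b !! n) / 3 ^ Suc n / 3)"
    using suminf_split_head[of "\<lambda>n. real ((c ## b) !! n) / 3 ^ Suc n"]
    by (simp add: delta3_def field_simps)
  also have "(\<Sum>n. real (b !! n) / 3 ^ Suc n / 3) = delta3 b / 3"
    unfolding delta3_def by (intro suminf_divide summable_delta3 assms)
  finally show ?thesis
    by (simp add: add_divide_distrib)
qed

text \<open>A constant stream is unchanged by prepending its digit, so its value is the fixed point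
  of the corresponding contraction.\<close>

lemma delta3_cycle_single:
  assumes "c \<in> digits"
  shows "delta3 (cycle [c]) = real c / 2"
proof -
  have "delta3 (cycle [c]) = delta3 (c ## cycle [c])"
    by (metis append_Nil cycle_Cons)
  also have "\<dots> = (real c + delta3 (cycle [c])) / 3"
    using assms by (intro delta3_SCons) simp_all
  finally show ?thesis
    by simp
qed

lemma delta3_shift:
  assumes "set cs \<subseteq> digits" and "sset b \<subseteq> digits"
  shows "delta3 (cs @- b) = delta3 (cs @- cycle [0]) + delta3 b / 3 ^ length cs"
  using assms(1)
proof (induction cs)
  case Nil
  then show ?case
    by (simp add: delta3_cycle_single)
next
  case (Cons c cs)
  have "delta3 ((c # cs) @- d) = (real c + delta3 (cs @- d)) / 3" if "sset d \<subseteq> digits" for d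
    using that Cons.prems by (simp add: delta3_SCons)
  from this[of b] this[of "cycle [0]"] show ?case
    using Cons assms(2) by (simp add: add_divide_distrib)
qed

text \<open>The expansion of \<open>x\<close> is the itinerary of \<open>x\<close> under the tripling map \<open>T\<close>, which inverts
  the contraction belonging to the leading digit. Comparing \<open>x\<close> with the value of its itinerary,
  one step of \<open>T\<close> multiplies the discrepancy by 3; as it never exceeds 1, it vanishes.\<close>

lemma delta3_surj:
  assumes "x \<in> {0..1}"
  shows "\<exists>b. sset b \<subseteq> digits \<and> x = delta3 b"
proof -
  define d :: "real \<Rightarrow> nat" where "d x = (if x < 1/3 then 0 else if x < 2/3 then 1 else 2)" for x
  define T where "T x = 3 * x - real (d x)" for x
  define e where "e x = smap d (siterate T x)" for x
  have d: "d x \<in> digits" for x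
    by (simp add: d_def)
  then have e: "sset (e x) \<subseteq> digits" for x
    unfolding e_def stream.set_map by (intro image_subsetI)
  have T: "T x \<in> {0..1}" if "x \<in> {0..1}" for x
    using that by (auto simp: T_def d_def)
  have step: "x - delta3 (e x) = (T x - delta3 (e (T x))) / 3" for x
  proof -
    have "e x = d x ## e (T x)"
      by (subst e_def, subst siterate.code) (simp add: e_def)
    then have "delta3 (e x) = (real (d x) + delta3 (e (T x))) / 3"
      using delta3_SCons[OF e d] by simp
    then show ?thesis
      by (simp add: T_def field_simps)
  qed
  have bound: "\<bar>x - delta3 (e x)\<bar> \<le> (1 / 3) ^ n" if "x \<in> {0..1}" for x n
    using that
  proof (induction n arbitrary: x)
    case 0
    then show ?case
      using delta3_bounds[OF e, of x] by auto
  next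
    case (Suc n)
    then show ?case
      using Suc.IH[OF T[OF Suc.prems]] by (subst step[of x]) simp
  qed
  have "(\<lambda>n. (1 / 3) ^ n :: real) \<longlonglongrightarrow> 0"
    by (intro LIMSEQ_realpow_zero) auto
  then have "\<bar>x - delta3 (e x)\<bar> \<le> 0"
    by (rule LIMSEQ_le_const) (use bound[OF assms] in blast)
  then show ?thesis
    using e by (intro exI[of _ "e x"]) simp
qed

lemma cylinder_eq:
  assumes "set cs \<subseteq> digits"
  defines "p \<equiv> delta3 (cs @- cycle [0])"
  shows "cylinder cs = {p .. p + 1 / 3 ^ length cs}"
proof (intro set_eqI iffI)
  fix x
  assume "x \<in> cylinder cs"
  then obtain b where b: "sset b \<subseteq> digits" "x = delta3 (cs @- b)"
    by (auto simp: cylinder_def)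
  then have "x = p + delta3 b / 3 ^ length cs"
    using delta3_shift[OF assms(1) b(1)] by (simp add: p_def)
  then show "x \<in> {p .. p + 1 / 3 ^ length cs}"
    using delta3_bounds[OF b(1)] by (simp add: divide_right_mono)
next
  fix x
  assume "x \<in> {p .. p + 1 / 3 ^ length cs}"
  then have "(x - p) * 3 ^ length cs \<in> {0..1}"
    by (simp add: field_simps)
  from delta3_surj[OF this] obtain b
    where b: "sset b \<subseteq> digits" "(x - p) * 3 ^ length cs = delta3 b"
    by (elim exE conjE) (rule that)
  have "delta3 (cs @- b) = p + delta3 b / 3 ^ length cs"
    using delta3_shift[OF assms(1) b(1)] by (simp add: p_def)
  also have "\<dots> = x"
    by (simp flip: b(2))
  finally show "x \<in> cylinder cs"
    using b(1) by (auto simp: cylinder_def)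
qed

lemma cylinder_snoc:
  assumes "set cs \<subseteq> digits" and "c \<in> digits"
  defines "p \<equiv> delta3 (cs @- cycle [0])" and "h \<equiv> 1 / 3 ^ Suc (length cs)"
  shows "cylinder (cs @ [c]) = {p + real c * h .. p + (real c + 1) * h}"
proof -
  have "delta3 ((cs @ [c]) @- cycle [0]) = delta3 (cs @- (c ## cycle [0]))"
    by simp
  also have "\<dots> = p + delta3 (c ## cycle [0]) / 3 ^ length cs"
    unfolding p_def using assms(1,2)
    by (intro delta3_shift) simp_all
  also have "delta3 (c ## cycle [0]) = real c / 3"
    using assms(2) by (simp add: delta3_SCons delta3_cycle_single)
  finally have "delta3 ((cs @ [c]) @- cycle [0]) = p + real c * h"
    by (simp add: h_def)
  moreover have "set (cs @ [c]) \<subseteq> digits"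
    using assms(1,2) by simp
  ultimately show ?thesis
    using cylinder_eq[of "cs @ [c]"] by (simp add: h_def algebra_simps add_divide_distrib)
qed

theorem lemma2:
  fixes n :: nat and cs :: "nat list"
  assumes "n \<ge> 1" and "length cs = n" and "set cs \<subseteq> digits"
  shows "cylinder cs = {delta3 (cs @- cycle [0]) .. delta3 (cs @- cycle [2])} \<and>
    measure lebesgue (cylinder cs) = 1 / 3 ^ n \<and>
    (\<forall>c\<in>digits. cylinder (cs @ [c]) \<subset> cylinder cs) \<and>
    cylinder cs = (\<Union>c\<in>digits. cylinder (cs @ [c])) \<and>
    (\<forall>c\<in>{0, 1}. Sup (cylinder (butlast cs @ [c])) = Inf (cylinder (butlast cs @ [c + 1])))"
proof (intro conjI)
  define p where "p = delta3 (cs @- cycle [0])"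
  define h :: real where "h = 1 / 3 ^ Suc n"
  have h: "h > 0"
    by (simp add: h_def)
  have cyl: "cylinder cs = {p .. p + 3 * h}"
    using cylinder_eq assms by (simp add: p_def h_def)
  have snoc: "cylinder (cs @ [c]) = {p + real c * h .. p + (real c + 1) * h}"
    if "c \<in> digits" for c
    using cylinder_snoc[OF assms(3) that] assms(2) by (simp add: p_def h_def)

  have "delta3 (cs @- cycle [2]) = p + 3 * h"
    using delta3_shift[OF assms(3), of "cycle [2]"] assms(2)
    by (simp add: p_def h_def delta3_cycle_single)
  then show "cylinder cs = {delta3 (cs @- cycle [0]) .. delta3 (cs @- cycle [2])}"
    using cyl by (simp add: p_def)
  show "measure lebesgue (cylinder cs) = 1 / 3 ^ n"
    using h by (simp add: cyl) (simp add: h_def)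
  show "cylinder cs = (\<Union>c\<in>digits. cylinder (cs @ [c]))"
    unfolding cyl using h snoc[of 0] snoc[of 1] snoc[of 2]
    by (simp add: ivl_disj_un_two_touch)
  show "\<forall>c\<in>digits. cylinder (cs @ [c]) \<subset> cylinder cs"
    \<comment> \<open>The inclusion is strict because each third misses one endpoint of its parent.\<close>
    using h by (auto simp: cyl snoc psubset_eq)

  have butlast: "set (butlast cs) \<subseteq> digits"
    using assms(3) by (meson in_set_butlastD subset_iff)
  define q where "q = delta3 (butlast cs @- cycle [0])"
  define k :: real where "k = 1 / 3 ^ Suc (length (butlast cs))"
  have k: "k > 0"
    by (simp add: k_def)
  have sib: "cylinder (butlast cs @ [c]) = {q + real c * k .. q + (real c + 1) * k}"
    if "c \<in> digits" for c
    using cylinder_snoc[OF butlast that] by (simp only: q_def k_def)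
  show "\<forall>c\<in>{0, 1}. Sup (cylinder (butlast cs @ [c])) = Inf (cylinder (butlast cs @ [c + 1]))"
    using k sib[of 0] sib[of 1] sib[of 2] by (simp add: numeral_2_eq_2)
qed

end
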